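(* Let $\mathcal{B}$ be an infinite complete ccc Boolean algebra and let $\mathcal{U}$ be a coherent $P$-ultrafilter on $\mathcal{B}$. Then $\mathcal{U}$ is an untouchable point in the Stone space of $\mathcal{B}$.
   Context: A partition of a Boolean algebra $\mathcal{B}$ is a maximal antichain, i.e. a maximal set of pairwise disjoint nonzero elements. In an infinite ccc algebra every infinite partition is countable, and is written $P = \{p_n : n \in \omega\}$ (enumerated without repetition). A $P$-ultrafilter on $\omega$ is an ultrafilter $\mathcal{V}$ on $\omega$ (principal ultrafilters allowed) such that for every partition $\{Q_n : n\in\omega\}$ of $\omega$ either $Q_n \in \mathcal{V}$ for some $n$, or there is $X \in \mathcal{V}$ with $X \cap Q_n$ finite for all $n$. An ultrafilter $\mathcal{U}$ on a complete ccc Boolean algebra $\mathcal{B}$ is a coherent $P$-ultrafilter if for every infinite partition $P = \{p_n : n\in\omega\}$ of $\mathcal{B}$, the family $\{A \subseteq \omega : \bigvee\{p_n : n \in A\} \in \mathcal{U}\}$ is a $P$-ultrafilter on $\omega$. A point $x$ of a topological space $X$ is an untouchable point if $x \notin \overline{D}$ for every countable nowhere dense subset $D \subseteq X$ not containing $x$. The Stone space of $\mathcal{B}$ is the space of all ultrafilters on $\mathcal{B}$ with the topology whose basic open sets are $\{\mathcal{V} : a \in \mathcal{V}\}$ for $a \in \mathcal{B}$. *)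

theory Defs
  imports "HOL-Analysis.Analysis"
begin

text \<open>
  A complete Boolean algebra is a type of sort \<open>{boolean_algebra, complete_lattice}\<close>. The library
  class \<^class>\<open>complete_boolean_algebra\<close> would be too strong: it is based on
  \<^class>\<open>complete_distrib_lattice\<close>, i.e. it requires complete distributivity, which forces the
  algebra to be atomic.
\<close>

definition ba_antichain :: "'a::boolean_algebra set \<Rightarrow> bool" where
  "ba_antichain A \<longleftrightarrow> bot \<notin> A \<and> pairwise (\<lambda>a b. inf a b = bot) A"

definition ba_partition :: "'a::boolean_algebra set \<Rightarrow> bool" where
  "ba_partition P \<longleftrightarrow> ba_antichain P \<and> (\<forall>Q. ba_antichain Q \<and> P \<subseteq> Q \<longrightarrow> Q = P)"

definition ccc :: "'a::boolean_algebra itself \<Rightarrow> bool" where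
  "ccc _ \<longleftrightarrow> (\<forall>A :: 'a set. ba_antichain A \<longrightarrow> countable A)"

text \<open>An ultrafilter on \<open>\<omega>\<close> is an ultrafilter on the Boolean algebra \<^typ>\<open>nat set\<close>.\<close>

definition ba_ultrafilter :: "'a::boolean_algebra set \<Rightarrow> bool" where
  "ba_ultrafilter U \<longleftrightarrow>
     top \<in> U \<and> bot \<notin> U \<and>
     (\<forall>a\<in>U. \<forall>b\<in>U. inf a b \<in> U) \<and>
     (\<forall>a\<in>U. \<forall>b. a \<le> b \<longrightarrow> b \<in> U) \<and>
     (\<forall>a. a \<in> U \<or> - a \<in> U)"

definition P_ultrafilter :: "nat set set \<Rightarrow> bool" where
  "P_ultrafilter V \<longleftrightarrow>
     ba_ultrafilter V \<and>
     (\<forall>Q :: nat \<Rightarrow> nat set. inj Q \<and> partition_on UNIV (range Q) \<longrightarrow>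
        (\<exists>n. Q n \<in> V) \<or> (\<exists>X\<in>V. \<forall>n. finite (X \<inter> Q n)))"

text \<open>
  Infinite partitions are given by their injective enumerations \<open>p\<close>; this covers all of them when
  the algebra is ccc.
\<close>

definition coherent_P_ultrafilter :: "'a::{boolean_algebra, complete_lattice} set \<Rightarrow> bool" where
  "coherent_P_ultrafilter U \<longleftrightarrow>
     ba_ultrafilter U \<and>
     (\<forall>p :: nat \<Rightarrow> 'a. inj p \<and> ba_partition (range p) \<longrightarrow>
        P_ultrafilter {A. Sup (p ` A) \<in> U})"

definition stone_basic :: "'a::boolean_algebra \<Rightarrow> 'a set set" where
  "stone_basic a = {V. ba_ultrafilter V \<and> a \<in> V}"

definition stone_space :: "'a::boolean_algebra set topology" where
  "stone_space = topology_generated_by (range stone_basic)"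

lemma topspace_stone_space: "topspace stone_space = {V. ba_ultrafilter V}"
  unfolding stone_space_def topology_generated_by_topspace
  by (auto simp: stone_basic_def ba_ultrafilter_def)

lemma stone_basic_inf: "stone_basic a \<inter> stone_basic b = stone_basic (inf a b)"
proof -
  have "inf a b \<in> V \<longleftrightarrow> a \<in> V \<and> b \<in> V" if "ba_ultrafilter V" for V
    using that unfolding ba_ultrafilter_def by (meson inf.cobounded1 inf.cobounded2)
  then show ?thesis by (auto simp: stone_basic_def)
qed

text \<open>The sets \<^const>\<open>stone_basic\<close> form a base of the topology, not just a subbase.\<close>

lemma openin_stone_space_iff:
  fixes S :: "'a::boolean_algebra set set"
  shows "openin stone_space S \<longleftrightarrow> (\<exists>A. S = (\<Union>a\<in>A. stone_basic a))"
proof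
  assume "openin stone_space S"
  then have "generate_topology_on (range stone_basic) S"
    unfolding stone_space_def by (rule openin_topology_generated_by)
  then show "\<exists>A. S = (\<Union>a\<in>A. stone_basic a)"
  proof induction
    case Empty
    show ?case by (rule exI[of _ "{}"]) simp
  next
    case (Int S T)
    then obtain A B where "S = (\<Union>a\<in>A. stone_basic a)" "T = (\<Union>b\<in>B. stone_basic b)"
      by blast
    then have "S \<inter> T = (\<Union>c\<in>(\<lambda>(a, b). inf a b) ` (A \<times> B). stone_basic c)"
      by (auto simp flip: stone_basic_inf)
    then show ?case by blast
  next
    case (UN K)
    then obtain A where "\<And>k. k \<in> K \<Longrightarrow> k = (\<Union>a\<in>A k. stone_basic a)"
      by metis
    then have "\<Union>K = (\<Union>a\<in>(\<Union>k\<in>K. A k). stone_basic a)"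
      by blast
    then show ?case by blast
  next
    case (Basis S)
    then obtain a where "S = stone_basic a" by blast
    then show ?case by (intro exI[of _ "{a}"]) simp
  qed
next
  assume "\<exists>A. S = (\<Union>a\<in>A. stone_basic a)"
  then obtain A where "S = (\<Union>a\<in>A. stone_basic a)" ..
  moreover have "openin stone_space (stone_basic a)" for a :: 'a
    unfolding stone_space_def by (rule topology_generated_by_Basis) simp
  ultimately show "openin stone_space S"
    by (auto intro: openin_Union)
qed

definition nowhere_dense_in :: "'a topology \<Rightarrow> 'a set \<Rightarrow> bool" where
  "nowhere_dense_in X D \<longleftrightarrow> D \<subseteq> topspace X \<and> X interior_of (X closure_of D) = {}"

definition untouchable_point :: "'a topology \<Rightarrow> 'a \<Rightarrow> bool" where
  "untouchable_point X x \<longleftrightarrow>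
     x \<in> topspace X \<and>
     (\<forall>D. countable D \<and> nowhere_dense_in X D \<and> x \<notin> D \<longrightarrow> x \<notin> X closure_of D)"

end

theory Submission
  imports Defs
begin

text \<open>
  Let \<open>D = {V\<^sub>n : n \<in> \<omega>}\<close> be nowhere dense with \<open>U \<notin> D\<close>. A point outside the closure of
  \<open>D\<close> is one with a member that belongs to no \<open>V\<^sub>n\<close>, so some \<open>b \<in> U\<close> avoiding all \<open>V\<^sub>n\<close> is
  wanted. Each single \<open>V\<^sub>n\<close> is avoided by some \<open>a\<^sub>n \<in> U\<close>, and coherence makes it possible to avoid
  all of them at once.

  Nowhere density of \<open>D\<close> says that the elements avoiding all \<open>V\<^sub>n\<close> are dense in the algebra
  (\<open>nowhere_dense_in_stone_space_dense\<close>; this rests on the Boolean prime ideal theorem). Shrinking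
  further, the elements \<open>w\<close> that moreover have a level are dense too: the level of \<open>w\<close> is \<open>n\<close> if
  \<open>w\<close> lies below \<open>a\<^sub>k\<close> for all \<open>k < n\<close> and is disjoint from \<open>a\<^sub>n\<close>, and it is infinite if \<open>w\<close> lies
  below all \<open>a\<^sub>k\<close>. A dense set contains a partition \<open>{w\<^sub>i}\<close> of the algebra
  (\<open>dense_set_contains_partition\<close>). If that is finite, one of its elements is in \<open>U\<close> and serves as
  \<open>b\<close>. Otherwise colour \<open>i \<in> \<omega>\<close> by the level of \<open>w\<^sub>i\<close> and apply the P-property of
  \<open>{A. \<Or>{w\<^sub>i : i \<in> A} \<in> U}\<close> (\<open>P_ultrafilter_colouring\<close>). The elements of a finite level \<open>n\<close> have a join
  disjoint from \<open>a\<^sub>n \<in> U\<close>, so that join is not in \<open>U\<close>. If the join of the elements of infinite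
  level is in \<open>U\<close>, it lies below every \<open>a\<^sub>n\<close> and serves as \<open>b\<close>. In the remaining case there is
  \<open>X\<close> with \<open>b = \<Or>{w\<^sub>i : i \<in> X} \<in> U\<close> that meets every level in a finite set. Then, for each \<open>n\<close>, all
  but finitely many of the \<open>w\<^sub>i\<close> with \<open>i \<in> X\<close> are below \<open>a\<^sub>n\<close>, so \<open>b\<close> lies below the join of
  \<open>a\<^sub>n\<close> and finitely many \<open>w\<^sub>i\<close>, none of which belongs to \<open>V\<^sub>n\<close>; hence \<open>b \<notin> V\<^sub>n\<close>.
\<close>

section \<open>Ultrafilters on Boolean algebras\<close>

lemma ba_ultrafilter_mono: "ba_ultrafilter U \<Longrightarrow> a \<in> U \<Longrightarrow> a \<le> b \<Longrightarrow> b \<in> U"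
  unfolding ba_ultrafilter_def by blast

lemma ba_ultrafilter_disjoint:
  assumes "ba_ultrafilter U" "a \<in> U" "b \<in> U"
  shows "inf a b \<noteq> bot"
  using assms unfolding ba_ultrafilter_def by metis

lemma ba_ultrafilter_sup:
  assumes U: "ba_ultrafilter U" and ab: "sup a b \<in> U"
  shows "a \<in> U \<or> b \<in> U"
proof (rule ccontr)
  assume "\<not> (a \<in> U \<or> b \<in> U)"
  then have "inf (- a) (- b) \<in> U"
    using U unfolding ba_ultrafilter_def by blast
  from ba_ultrafilter_disjoint[OF U ab this] show False
    by (simp flip: compl_sup)
qed

lemma ba_ultrafilter_finite_Sup:
  fixes U :: "'a::{boolean_algebra, complete_lattice} set"
  assumes U: "ba_ultrafilter U" and "finite S" "Sup S \<in> U"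
  shows "\<exists>s\<in>S. s \<in> U"
  using assms(2,3)
proof (induction S)
  case empty
  then show ?case using U by (simp add: ba_ultrafilter_def)
next
  case (insert x S)
  then show ?case using ba_ultrafilter_sup[OF U, of x "Sup S"] by auto
qed

lemma ba_ultrafilter_separate:
  assumes U: "ba_ultrafilter U" and V: "ba_ultrafilter V" and "V \<noteq> U"
  shows "\<exists>a\<in>U. a \<notin> V"
proof (rule ccontr)
  assume "\<not> ?thesis"
  then have UV: "U \<subseteq> V" by blast
  have "v \<in> U" if "v \<in> V" for v
  proof (rule ccontr)
    assume "v \<notin> U"
    then have "- v \<in> V" using U UV unfolding ba_ultrafilter_def by blast
    from ba_ultrafilter_disjoint[OF V that this] show False by simp
  qed
  with UV \<open>V \<noteq> U\<close> show False by blast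
qed

text \<open>
  The Boolean prime ideal theorem: an ultrafilter is a maximal proper filter containing \<open>c\<close>, because
  a maximal filter \<open>M\<close> with \<open>a \<notin> M\<close> becomes improper when \<open>a\<close> is added, so that some member of \<open>M\<close>
  is disjoint from \<open>a\<close>.
\<close>

lemma ba_ultrafilter_exists:
  fixes c :: "'a::boolean_algebra"
  assumes "c \<noteq> bot"
  shows "\<exists>V. ba_ultrafilter V \<and> c \<in> V"
proof -
  define \<F> where "\<F> = {F :: 'a set. c \<in> F \<and> bot \<notin> F \<and> (\<forall>a\<in>F. \<forall>b\<in>F. inf a b \<in> F)
    \<and> (\<forall>a\<in>F. \<forall>b. a \<le> b \<longrightarrow> b \<in> F)}"
  have "{x. c \<le> x} \<in> \<F>"
    using assms by (auto simp: \<F>_def bot_unique)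
  then have "\<F> \<noteq> {}" by blast
  moreover have "\<Union>C \<in> \<F>" if "C \<noteq> {}" "subset.chain \<F> C" for C
  proof -
    have sub: "C \<subseteq> \<F>" and lin: "\<And>F G. F \<in> C \<Longrightarrow> G \<in> C \<Longrightarrow> F \<subseteq> G \<or> G \<subseteq> F"
      using that(2) by (auto simp: subset_chain_def)
    have "inf a b \<in> \<Union>C" if ab: "a \<in> \<Union>C" "b \<in> \<Union>C" for a b
    proof -
      obtain F G where "F \<in> C" "a \<in> F" "G \<in> C" "b \<in> G" using ab by blast
      with lin obtain H where "H \<in> C" "a \<in> H" "b \<in> H" by blast
      then show ?thesis using sub by (auto simp: \<F>_def)
    qed
    moreover have "c \<in> \<Union>C" "bot \<notin> \<Union>C" "\<forall>a\<in>\<Union>C. \<forall>b. a \<le> b \<longrightarrow> b \<in> \<Union>C"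
      using sub that(1) unfolding \<F>_def by blast+
    ultimately show ?thesis by (simp add: \<F>_def)
  qed
  ultimately obtain M where M: "M \<in> \<F>" and max: "\<And>X. X \<in> \<F> \<Longrightarrow> M \<subseteq> X \<Longrightarrow> X = M"
    using subset_Zorn_nonempty[of \<F>] by blast
  have c: "c \<in> M" and bot: "bot \<notin> M" and inf: "\<And>a b. a \<in> M \<Longrightarrow> b \<in> M \<Longrightarrow> inf a b \<in> M"
    and up: "\<And>a b. a \<in> M \<Longrightarrow> a \<le> b \<Longrightarrow> b \<in> M"
    using M by (auto simp: \<F>_def)
  have "- a \<in> M" if "a \<notin> M" for a
  proof -
    \<comment> \<open>the filter generated by \<open>M\<close> and \<open>a\<close>\<close>
    let ?N = "{x. \<exists>m\<in>M. inf m a \<le> x}"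
    have "M \<subseteq> ?N" using le_infI1 by blast
    moreover have "a \<in> ?N" using c by auto
    ultimately have "?N \<notin> \<F>" using max that by blast
    moreover have "inf x y \<in> ?N" if xy: "x \<in> ?N" "y \<in> ?N" for x y
    proof -
      obtain m n where m: "m \<in> M" "inf m a \<le> x" and n: "n \<in> M" "inf n a \<le> y"
        using xy by blast
      have "inf (inf m n) a = inf (inf m a) (inf n a)" by (simp add: inf_aci)
      also have "\<dots> \<le> inf x y" using m(2) n(2) by (rule inf_mono)
      finally show ?thesis using inf[OF m(1) n(1)] by blast
    qed
    moreover have "c \<in> ?N" using c \<open>M \<subseteq> ?N\<close> by blast
    moreover have "\<forall>x\<in>?N. \<forall>y. x \<le> y \<longrightarrow> y \<in> ?N" using order_trans by blast
    ultimately have "bot \<in> ?N" unfolding \<F>_def by blast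
    then obtain m where "m \<in> M" "inf m a = bot" by (auto simp: bot_unique)
    then show ?thesis using up inf_shunt by blast
  qed
  then have "ba_ultrafilter M"
    unfolding ba_ultrafilter_def using c bot inf up top_greatest by blast
  with c show ?thesis by blast
qed

section \<open>Partitions of Boolean algebras\<close>

text \<open>
  An antichain that is maximal among the subsets of \<open>G\<close> is maximal outright: if some \<open>q\<close> could be
  added to it, then so could an element of \<open>G\<close> below \<open>q\<close>.
\<close>

lemma dense_set_contains_partition:
  fixes G :: "'a::boolean_algebra set"
  assumes dense: "\<And>c. c \<noteq> bot \<Longrightarrow> \<exists>g\<in>G. g \<noteq> bot \<and> g \<le> c"
  shows "\<exists>W\<subseteq>G. ba_partition W"
proof -
  define \<A> where "\<A> = {A. A \<subseteq> G \<and> ba_antichain A}"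
  have "\<Union>C \<in> \<A>" if "subset.chain \<A> C" for C
  proof -
    have sub: "C \<subseteq> \<A>" and lin: "\<And>F G. F \<in> C \<Longrightarrow> G \<in> C \<Longrightarrow> F \<subseteq> G \<or> G \<subseteq> F"
      using that by (auto simp: subset_chain_def)
    have "inf a b = bot" if "a \<in> \<Union>C" "b \<in> \<Union>C" "a \<noteq> b" for a b
    proof -
      obtain F G where "F \<in> C" "a \<in> F" "G \<in> C" "b \<in> G" using \<open>a \<in> \<Union>C\<close> \<open>b \<in> \<Union>C\<close> by blast
      with lin obtain H where "H \<in> C" "a \<in> H" "b \<in> H" by blast
      then show ?thesis
        using sub \<open>a \<noteq> b\<close> by (auto simp: \<A>_def ba_antichain_def pairwise_def)
    qed
    moreover have "\<Union>C \<subseteq> G" "bot \<notin> \<Union>C"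
      using sub by (auto simp: \<A>_def ba_antichain_def)
    ultimately show ?thesis by (simp add: \<A>_def ba_antichain_def pairwise_def)
  qed
  then have "\<exists>W\<in>\<A>. \<forall>X\<in>\<A>. W \<subseteq> X \<longrightarrow> X = W" by (rule subset_Zorn')
  then obtain W where W: "W \<in> \<A>" and max: "\<And>X. X \<in> \<A> \<Longrightarrow> W \<subseteq> X \<Longrightarrow> X = W"
    by blast
  have "Q = W" if Q: "ba_antichain Q" "W \<subseteq> Q" for Q
  proof (rule ccontr)
    assume "Q \<noteq> W"
    then obtain q where q: "q \<in> Q" "q \<notin> W" using Q by blast
    then have "q \<noteq> bot" using Q by (auto simp: ba_antichain_def)
    then obtain g where g: "g \<in> G" "g \<noteq> bot" "g \<le> q" using dense by blast
    have qw: "inf q w = bot" if "w \<in> W" for w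
    proof -
      have "w \<in> Q" "q \<noteq> w" using Q(2) q(2) that by auto
      with Q(1) q(1) show ?thesis by (simp add: ba_antichain_def pairwise_def)
    qed
    have gw: "inf g w = bot" if "w \<in> W" for w
      using qw[OF that] inf_mono[OF g(3) order_refl, of w] by (simp add: bot_unique)
    then have "g \<notin> W" using g(2) by force
    have "insert g W \<in> \<A>"
      using W g gw by (auto simp: \<A>_def ba_antichain_def pairwise_insert inf_commute)
    with max \<open>g \<notin> W\<close> show False by blast
  qed
  then show ?thesis using W unfolding ba_partition_def \<A>_def by blast
qed

lemma ba_partition_Sup:
  fixes W :: "'a::{boolean_algebra, complete_lattice} set"
  assumes "ba_partition W"
  shows "Sup W = top"
proof (rule ccontr)
  assume "Sup W \<noteq> top"
  let ?r = "- Sup W"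
  have ne: "?r \<noteq> bot" using \<open>Sup W \<noteq> top\<close> by (metis compl_bot_eq double_compl)
  have "inf w ?r = bot" if "w \<in> W" for w
    using Sup_upper[OF that] by (simp add: inf_shunt)
  then have "ba_antichain (insert ?r W)"
    using assms ne
    by (auto simp: ba_partition_def ba_antichain_def pairwise_insert inf_commute)
  then have "?r \<in> W" using assms unfolding ba_partition_def by blast
  then have "?r \<le> Sup W" by (rule Sup_upper)
  then have "inf ?r ?r = bot" using inf_shunt[of ?r ?r] by simp
  with ne show False by simp
qed

section \<open>P-ultrafilters and colourings\<close>

text \<open>
  The fibres of a colouring form a partition only after discarding the empty ones, and if finitely
  many remain they have no injective enumeration by \<open>\<omega>\<close>; but then one of them belongs to the
  ultrafilter outright.
\<close>

lemma P_ultrafilter_colouring: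
  fixes f :: "nat \<Rightarrow> nat"
  assumes V: "P_ultrafilter V"
  shows "(\<exists>n. f -` {n} \<in> V) \<or> (\<exists>X\<in>V. \<forall>n. finite (X \<inter> f -` {n}))"
proof (cases "finite (range f)")
  case True
  have uf: "ba_ultrafilter V" using V by (simp add: P_ultrafilter_def)
  have "Sup ((\<lambda>n. f -` {n}) ` range f) = UNIV" by auto
  then have "Sup ((\<lambda>n. f -` {n}) ` range f) \<in> V"
    using uf by (simp add: ba_ultrafilter_def)
  from ba_ultrafilter_finite_Sup[OF uf _ this] True show ?thesis by auto
next
  case False
  define e where "e = from_nat_into (range f)"
  have e: "bij_betw e UNIV (range f)"
    unfolding e_def using False by (intro bij_betw_from_nat_into) auto
  then have inj_e: "inj e" and ran_e: "range e = range f"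
    by (auto simp: bij_betw_def)
  let ?Q = "\<lambda>k. f -` {e k}"
  have ne: "?Q k \<noteq> {}" for k
    using ran_e by (metis (no_types, lifting) empty_iff rangeE rangeI vimage_singleton_eq)
  have "inj ?Q"
  proof (rule injI)
    fix k l assume eq: "?Q k = ?Q l"
    obtain x where "x \<in> ?Q k" using ne[of k] by blast
    with eq have "e k = e l" by auto
    with inj_e show "k = l" by (simp add: inj_eq)
  qed
  moreover have "partition_on UNIV (range ?Q)"
  proof (rule partition_onI)
    have "\<exists>k. f x = e k" for x using ran_e by (metis rangeE rangeI)
    then show "\<Union> (range ?Q) = UNIV" by blast
  next
    show "\<And>p q. p \<in> range ?Q \<Longrightarrow> q \<in> range ?Q \<Longrightarrow> p \<noteq> q \<Longrightarrow> disjnt p q"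
      by (auto simp: disjnt_def)
  next
    show "{} \<notin> range ?Q" using ne by auto
  qed
  ultimately consider k where "?Q k \<in> V" | X where "X \<in> V" "\<forall>k. finite (X \<inter> ?Q k)"
    using V unfolding P_ultrafilter_def by blast
  then show ?thesis
  proof cases
    case 2
    have "finite (X \<inter> f -` {n})" for n
    proof (cases "n \<in> range f")
      case True
      then obtain k where "n = e k" using ran_e by blast
      then show ?thesis using 2(2) by blast
    next
      case False
      then have "f -` {n} = {}" by auto
      then show ?thesis by simp
    qed
    with 2(1) show ?thesis by blast
  qed blast
qed

section \<open>The topology of the Stone space\<close>

lemma not_in_closure_stone_space:
  assumes "ba_ultrafilter V"
  shows "V \<notin> stone_space closure_of D \<longleftrightarrow> (\<exists>b\<in>V. \<forall>W\<in>D. ba_ultrafilter W \<longrightarrow> b \<notin> W)"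
proof
  assume "V \<notin> stone_space closure_of D"
  then obtain T where T: "openin stone_space T" "V \<in> T" "D \<inter> T = {}"
    using assms by (auto simp: in_closure_of topspace_stone_space)
  then obtain b where b: "V \<in> stone_basic b" "stone_basic b \<subseteq> T"
    by (auto simp: openin_stone_space_iff)
  then show "\<exists>b\<in>V. \<forall>W\<in>D. ba_ultrafilter W \<longrightarrow> b \<notin> W"
    using T(3) by (auto simp: stone_basic_def)
next
  assume "\<exists>b\<in>V. \<forall>W\<in>D. ba_ultrafilter W \<longrightarrow> b \<notin> W"
  then obtain b where "b \<in> V" "\<forall>W\<in>D. ba_ultrafilter W \<longrightarrow> b \<notin> W" by blast
  then have "V \<in> stone_basic b" "D \<inter> stone_basic b = {}"
    using assms by (auto simp: stone_basic_def)
  moreover have "openin stone_space (stone_basic b)"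
    unfolding openin_stone_space_iff by (intro exI[of _ "{b}"]) simp
  ultimately show "V \<notin> stone_space closure_of D"
    by (auto simp: in_closure_of)
qed

text \<open>
  The nonempty open set \<open>stone_basic c\<close> is not contained in the closure of \<open>D\<close>; shrink it to a
  basic neighbourhood of one of its points outside that closure.
\<close>

lemma nowhere_dense_in_stone_space_dense:
  fixes c :: "'a::boolean_algebra"
  assumes D: "nowhere_dense_in stone_space D" and "c \<noteq> bot"
  shows "\<exists>d\<le>c. d \<noteq> bot \<and> (\<forall>W\<in>D. d \<notin> W)"
proof -
  have sub: "D \<subseteq> {V. ba_ultrafilter V}"
    and int: "stone_space interior_of (stone_space closure_of D) = {}"
    using D by (auto simp: nowhere_dense_in_def topspace_stone_space)
  have "openin stone_space (stone_basic c)"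
    unfolding openin_stone_space_iff by (intro exI[of _ "{c}"]) simp
  moreover have "stone_basic c \<noteq> {}"
    using ba_ultrafilter_exists[OF \<open>c \<noteq> bot\<close>] by (auto simp: stone_basic_def)
  ultimately have "\<not> stone_basic c \<subseteq> stone_space closure_of D"
    using int interior_of_maximal by blast
  then obtain V where V: "ba_ultrafilter V" "c \<in> V" "V \<notin> stone_space closure_of D"
    unfolding stone_basic_def by blast
  from V(3) obtain b where b: "b \<in> V" "\<forall>W\<in>D. b \<notin> W"
    unfolding not_in_closure_stone_space[OF V(1)] using sub by blast
  have "inf c b \<noteq> bot" using V(1,2) b(1) by (rule ba_ultrafilter_disjoint)
  moreover have "inf c b \<notin> W" if "W \<in> D" for W
    using b(2) that sub ba_ultrafilter_mono[of W "inf c b" b] by auto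
  ultimately show ?thesis by (intro exI[of _ "inf c b"]) simp
qed

section \<open>Avoiding countably many ultrafilters\<close>

lemma coherent_P_ultrafilter_avoids:
  fixes U :: "'a::{boolean_algebra, complete_lattice} set" and V :: "nat \<Rightarrow> 'a set"
  assumes ccc: "ccc TYPE('a)" and U: "coherent_P_ultrafilter U"
    and V: "\<And>n. ba_ultrafilter (V n)" "\<And>n. V n \<noteq> U"
    and dense: "\<And>c. c \<noteq> bot \<Longrightarrow> \<exists>d\<le>c. d \<noteq> bot \<and> (\<forall>n. d \<notin> V n)"
  shows "\<exists>b\<in>U. \<forall>n. b \<notin> V n"
proof -
  have ufU: "ba_ultrafilter U" using U by (simp add: coherent_P_ultrafilter_def)
  obtain a where a: "\<And>n. a n \<in> U" "\<And>n. a n \<notin> V n"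
    using ba_ultrafilter_separate[OF ufU V] by metis
  \<comment> \<open>Level \<open>n\<close> is coded as \<open>Suc n\<close> and the infinite level as \<open>0\<close>.\<close>
  define lev where "lev w l \<longleftrightarrow>
    (case l of 0 \<Rightarrow> \<forall>k. w \<le> a k | Suc n \<Rightarrow> w \<le> - a n \<and> (\<forall>k<n. w \<le> a k))" for w l
  define G where "G = {w. (\<forall>n. w \<notin> V n) \<and> (\<exists>l. lev w l)}"
  have "\<exists>g\<in>G. g \<noteq> bot \<and> g \<le> c" if c: "c \<noteq> bot" for c
  proof -
    obtain d where d: "d \<le> c" "d \<noteq> bot" "\<And>n. d \<notin> V n" using dense[OF c] by auto
    show ?thesis
    proof (cases "\<forall>k. d \<le> a k")
      case True
      then have "lev d 0" by (simp add: lev_def)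
      then have "d \<in> G" using d(3) by (auto simp: G_def)
      with d(1,2) show ?thesis by blast
    next
      case False
      define n where "n = (LEAST k. \<not> d \<le> a k)"
      have n: "\<not> d \<le> a n" "\<And>k. k < n \<Longrightarrow> d \<le> a k"
        unfolding n_def using False LeastI_ex[of "\<lambda>k. \<not> d \<le> a k"] not_less_Least by blast+
      let ?w = "inf d (- a n)"
      have "?w \<noteq> bot" using n(1) inf_shunt[of d "- a n"] by auto
      have "lev ?w (Suc n)" using n(2) by (simp add: lev_def le_infI1)
      moreover have "?w \<notin> V m" for m
        using d(3) ba_ultrafilter_mono[OF V(1)[of m], of ?w d] by auto
      ultimately have "?w \<in> G" by (auto simp: G_def)
      moreover have "?w \<le> c" using d(1) by (rule le_infI1)
      ultimately show ?thesis using \<open>?w \<noteq> bot\<close> by blast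
    qed
  qed
  from dense_set_contains_partition[OF this]
  obtain W where WG: "W \<subseteq> G" and W: "ba_partition W" by auto
  show ?thesis
  proof (cases "finite W")
    case True
    have "Sup W \<in> U"
      using ba_partition_Sup[OF W] ufU by (simp add: ba_ultrafilter_def)
    from ba_ultrafilter_finite_Sup[OF ufU True this] WG show ?thesis by (auto simp: G_def)
  next
    case False
    have "countable W" using ccc W by (auto simp: ccc_def ba_partition_def)
    then have "bij_betw (from_nat_into W) UNIV W"
      using False by (rule bij_betw_from_nat_into)
    then obtain w :: "nat \<Rightarrow> 'a" where inj: "inj w" and ran: "range w = W"
      by (auto simp: bij_betw_def)
    have wV: "w i \<notin> V n" for i n using ran WG by (auto simp: G_def)
    have "\<exists>l. lev (w i) l" for i using ran WG by (auto simp: G_def)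
    then obtain f where f: "\<And>i. lev (w i) (f i)" by metis
    have "P_ultrafilter {A. Sup (w ` A) \<in> U}"
      using U inj ran W by (simp add: coherent_P_ultrafilter_def)
    from P_ultrafilter_colouring[OF this, of f]
    consider l where "Sup (w ` (f -` {l})) \<in> U"
      | X where "Sup (w ` X) \<in> U" "\<And>l. finite (X \<inter> f -` {l})"
      by auto
    then show ?thesis
    proof cases
      case 1
      let ?b = "Sup (w ` (f -` {l}))"
      show ?thesis
      proof (cases l)
        case 0
        have "w i \<le> a n" if "f i = l" for i n
          using f[of i] that by (simp add: lev_def 0)
        then have "?b \<le> a n" for n by (auto intro: Sup_least)
        then have "?b \<notin> V n" for n using a(2) ba_ultrafilter_mono V(1) by blast
        with 1 show ?thesis by blast
      next
        case (Suc n)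
        have "w i \<le> - a n" if "f i = l" for i
          using f[of i] that by (simp add: lev_def Suc)
        then have "?b \<le> - a n" by (auto intro: Sup_least)
        then have "- a n \<in> U" using 1 ba_ultrafilter_mono ufU by blast
        from ba_ultrafilter_disjoint[OF ufU a(1)[of n] this] show ?thesis by simp
      qed
    next
      case 2
      have "Sup (w ` X) \<notin> V n" for n
      proof
        assume b: "Sup (w ` X) \<in> V n"
        \<comment> \<open>the indices in \<open>X\<close> of a finite level at most \<open>n\<close>, given that \<open>0\<close> codes infinity\<close>
        define E where "E = (\<Union>l\<in>{1..Suc n}. X \<inter> f -` {l})"
        have "finite E" unfolding E_def using 2(2) by blast
        have "w i \<le> sup (a n) (Sup (w ` E))" if "i \<in> X" for i
        proof (cases "i \<in> E")
          case True
          then show ?thesis by (intro le_supI2 Sup_upper) simp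
        next
          case False
          then have "f i = 0 \<or> f i > Suc n" using that by (auto simp: E_def)
          then have "w i \<le> a n" using f[of i] by (auto simp: lev_def split: nat.splits)
          then show ?thesis by (rule le_supI1)
        qed
        then have "Sup (w ` X) \<le> sup (a n) (Sup (w ` E))" by (auto intro: Sup_least)
        then have "sup (a n) (Sup (w ` E)) \<in> V n" using b ba_ultrafilter_mono V(1) by blast
        then have "Sup (w ` E) \<in> V n" using ba_ultrafilter_sup[OF V(1)] a(2) by blast
        from ba_ultrafilter_finite_Sup[OF V(1) _ this] \<open>finite E\<close> wV show False by auto
      qed
      with 2(1) show ?thesis by blast
    qed
  qed
qed

theorem proposition4p3:
  fixes U :: "'a::{boolean_algebra, complete_lattice} set"
  assumes "infinite (UNIV :: 'a set)"
    and "ccc TYPE('a)"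
    and "coherent_P_ultrafilter U"
  shows "untouchable_point stone_space U"
proof -
  have U: "ba_ultrafilter U" using assms(3) by (simp add: coherent_P_ultrafilter_def)
  have "U \<notin> stone_space closure_of D"
    if D: "countable D" "nowhere_dense_in stone_space D" "U \<notin> D" for D
  proof (cases "D = {}")
    case True
    then show ?thesis by simp
  next
    case False
    let ?V = "from_nat_into D"
    have ran: "range ?V = D" using False D(1) by (rule range_from_nat_into)
    then have VD: "?V n \<in> D" for n by blast
    have uf: "ba_ultrafilter W" if "W \<in> D" for W
      using D(2) that by (auto simp: nowhere_dense_in_def topspace_stone_space)
    have "\<exists>d\<le>c. d \<noteq> bot \<and> (\<forall>n. d \<notin> ?V n)" if "c \<noteq> bot" for c
      using nowhere_dense_in_stone_space_dense[OF D(2) that] VD by blast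
    then have "\<exists>b\<in>U. \<forall>n. b \<notin> ?V n"
      using coherent_P_ultrafilter_avoids[OF assms(2,3), of ?V] VD uf D(3) by blast
    then have "\<exists>b\<in>U. \<forall>W\<in>D. b \<notin> W" by (metis ran rangeE)
    then show ?thesis unfolding not_in_closure_stone_space[OF U] by blast
  qed
  then show ?thesis
    using U unfolding untouchable_point_def topspace_stone_space by blast
qed

end
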